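(* For any SLH formula $\forall h . \phi$, if there is a counterexample interpretation $\Gamma$ with $\Gamma \models \neg \phi$, then there is an interpretation $\Gamma'$ with $\Gamma' \models \neg \phi$ in which every heap-sorted variable is interpreted by a homeomorphism kernel.
   Context: SLH is the theory of singly-linked lists with length over a background arithmetic theory $\mathcal{T_B}$. Its formulae are boolean combinations of $\mathcal{T_B}$-literals and heap functions $\mathit{alias}(h,x,y)$, $\mathit{isPath}(h,x,y)$, $\mathit{pathLength}(h,x,y)$, $\mathit{isNull}(h,x)$, $\mathit{circular}(h,x)$ and heap transformers $h'=\mathit{new}(h,x)$, $h'=\mathit{assign}(h,x,y)$, $h'=\mathit{lookup}(h,x,y)$, $h'=\mathit{update}(h,x,y)$. Here $h,h'$ are heap variables, $x,y$ range over a finite set $P$ of pointer variables (including $\mathbf{null}$), and an interpretation $\Gamma$ maps free variables to elements of the appropriate sort. A heap is a pair $H=\langle L,G\rangle$ with $G$ a finite graph whose edges carry weights in $\mathbb{N}$ (default weight 1) and $L:P\to V(G)$ a labelling. $H$ is a singly linked heap if every vertex has outdegree 1 except a single sink of outdegree 0 labelled by $\mathbf{null}$. $\mathit{pathLength}(H,x,y)$ is the minimal total weight of a path from $L(x)$ to $L(y)$ (or $\infty$ if there is none), and $\mathit{circular}(H,x)$ holds iff there is a non-empty path from $L(x)$ back to $L(x)$. An edge subdivision replaces an edge $(u,v)$ by $(u,q),(q,v)$ with a fresh vertex $q$ and weights summing to $w(u,v)$. Smoothing is the inverse operation, removing an unlabelled vertex with a single incoming edge. Two heaps are homeomorphic ($H\sim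 H'$) iff some subdivision of $H$ is isomorphic, via a graph isomorphism on the parts reachable from $P$ that respects the labelling, to some subdivision of $H'$. The kernel $\mathrm{Ke}(H)$ is the maximally smoothed heap in the homeomorphism class of $H$. It is proved that homeomorphism is sound: homeomorphic heaps agree on all $\mathit{pathLength}$ and $\mathit{circular}$ observations, and each transformer maps homeomorphic heaps to homeomorphic heaps. It is also proved that kernels are small: $\|\mathrm{Ke}(H)\|\le 2\times\|P\|$ vertices.
   Formalization: The equality in h' = new/assign/lookup/update(...) is read as equality up to homeomorphism (with literal equality the claim fails, e.g. h' = assign(h,x,null) can leave a smoothable vertex), and edge weights are taken to be positive naturals. *)

theory Defs
  imports "HOL-Library.Extended_Nat"
begin

text \<open>
  The finite set \<open>P\<close> of pointer variables is an arbitrary finite type with a distinguished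
  element for null.
\<close>

class pointer = finite +
  fixes null_ptr :: 'a

section \<open>Heaps\<close>

text \<open>
  Only finite heaps matter, so vertices are drawn from an infinite supply of names, the natural
  numbers. The values of \<open>weight\<close> off the edge set are meaningless.
\<close>

record 'p heap =
  verts :: "nat set"
  edges :: "(nat \<times> nat) set"
  weight :: "nat \<times> nat \<Rightarrow> nat"
  label :: "'p \<Rightarrow> nat"

text \<open>
  Weights are positive: an edge of weight \<open>n\<close> stands for \<open>n\<close> consecutive list cells. With
  weight 0, subdividing would not be compatible with \<open>lookup\<close>.
\<close>

definition heap :: "'p heap \<Rightarrow> bool" where
  "heap H \<longleftrightarrow> finite (verts H) \<and> edges H \<subseteq> verts H \<times> verts H \<and>
     (\<forall>e\<in>edges H. 0 < weight H e) \<and> range (label H) \<subseteq> verts H"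

definition singly_linked :: "'p::pointer heap \<Rightarrow> bool" where
  "singly_linked H \<longleftrightarrow> heap H \<and>
     (\<forall>v\<in>verts H. card {t. (v, t) \<in> edges H} = (if v = label H null_ptr then 0 else 1))"

inductive path :: "'p heap \<Rightarrow> nat \<Rightarrow> nat \<Rightarrow> nat \<Rightarrow> bool" for H where
  "v \<in> verts H \<Longrightarrow> path H v 0 v"
| "(u, v) \<in> edges H \<Longrightarrow> path H v n t \<Longrightarrow> path H u (weight H (u, v) + n) t"

text \<open>The infimum of the empty set is \<open>\<infinity>\<close>.\<close>

definition path_length :: "'p heap \<Rightarrow> 'p \<Rightarrow> 'p \<Rightarrow> enat" where
  "path_length H x y = Inf {enat n | n. path H (label H x) n (label H y)}"

definition is_path :: "'p heap \<Rightarrow> 'p \<Rightarrow> 'p \<Rightarrow> bool" where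
  "is_path H x y \<longleftrightarrow> (label H x, label H y) \<in> (edges H)\<^sup>*"

definition is_alias :: "'p heap \<Rightarrow> 'p \<Rightarrow> 'p \<Rightarrow> bool" where
  "is_alias H x y \<longleftrightarrow> label H x = label H y"

definition is_null :: "'p::pointer heap \<Rightarrow> 'p \<Rightarrow> bool" where
  "is_null H x \<longleftrightarrow> label H x = label H null_ptr"

definition circular :: "'p heap \<Rightarrow> 'p \<Rightarrow> bool" where
  "circular H x \<longleftrightarrow> (label H x, label H x) \<in> (edges H)\<^sup>+"

section \<open>Homeomorphism and kernels\<close>

definition subdivides :: "'p heap \<Rightarrow> 'p heap \<Rightarrow> bool" where
  "subdivides H H' \<longleftrightarrow> (\<exists>u v q. (u, v) \<in> edges H \<and> q \<notin> verts H \<and>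
     verts H' = insert q (verts H) \<and>
     edges H' = (edges H - {(u, v)}) \<union> {(u, q), (q, v)} \<and>
     (\<forall>e \<in> edges H - {(u, v)}. weight H' e = weight H e) \<and>
     0 < weight H' (u, q) \<and> 0 < weight H' (q, v) \<and>
     weight H' (u, q) + weight H' (q, v) = weight H (u, v) \<and>
     label H' = label H)"

text \<open>
  Since \<open>H'\<close> is required to be a heap, the removed vertex is unlabelled and has a single incoming
  and a single outgoing edge.
\<close>

definition smooths :: "'p heap \<Rightarrow> 'p heap \<Rightarrow> bool" where
  "smooths H H' \<longleftrightarrow> heap H' \<and> subdivides H' H"

definition reachable :: "'p heap \<Rightarrow> nat set" where
  "reachable H = {v. \<exists>p. (label H p, v) \<in> (edges H)\<^sup>*}"

definition isomorphic :: "'p heap \<Rightarrow> 'p heap \<Rightarrow> bool" where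
  "isomorphic H H' \<longleftrightarrow> (\<exists>f. bij_betw f (reachable H) (reachable H') \<and>
     (\<forall>u\<in>reachable H. \<forall>v\<in>reachable H.
        ((u, v) \<in> edges H \<longleftrightarrow> (f u, f v) \<in> edges H') \<and>
        ((u, v) \<in> edges H \<longrightarrow> weight H' (f u, f v) = weight H (u, v))) \<and>
     (\<forall>p. f (label H p) = label H' p))"

definition homeomorphic :: "'p heap \<Rightarrow> 'p heap \<Rightarrow> bool" (infix "\<sim>" 50) where
  "H \<sim> H' \<longleftrightarrow>
     (\<exists>S S'. subdivides\<^sup>*\<^sup>* H S \<and> subdivides\<^sup>*\<^sup>* H' S' \<and> isomorphic S S')"

text \<open>
  A homeomorphism class does not constrain the vertices that are unreachable from \<open>P\<close>, so its
  maximally smoothed member has none.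
\<close>

definition is_kernel_of :: "'p::pointer heap \<Rightarrow> 'p heap \<Rightarrow> bool" where
  "is_kernel_of K H \<longleftrightarrow> singly_linked K \<and> K \<sim> H \<and>
     verts K = reachable K \<and> (\<nexists>K'. smooths K K')"

definition homeomorphism_kernel :: "'p::pointer heap \<Rightarrow> bool" where
  "homeomorphism_kernel K \<longleftrightarrow> (\<exists>H. singly_linked H \<and> is_kernel_of K H)"

section \<open>Heap transformers\<close>

text \<open>
  Transformers are relations between the old and the new heap: fresh vertices are chosen
  arbitrarily, and \<open>lookup\<close> and \<open>update\<close> are undefined when they dereference null.
  A fresh cell points to null.
\<close>

definition new_heap :: "'p::pointer \<Rightarrow> 'p heap \<Rightarrow> 'p heap \<Rightarrow> bool" where
  "new_heap x H H' \<longleftrightarrow> (\<exists>q. q \<notin> verts H \<and>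
     H' = H\<lparr>verts := insert q (verts H),
            edges := insert (q, label H null_ptr) (edges H),
            weight := (weight H)((q, label H null_ptr) := 1),
            label := (label H)(x := q)\<rparr>)"

definition assign_heap :: "'p \<Rightarrow> 'p \<Rightarrow> 'p heap \<Rightarrow> 'p heap \<Rightarrow> bool" where
  "assign_heap x y H H' \<longleftrightarrow> H' = H\<lparr>label := (label H)(x := label H y)\<rparr>"

text \<open>
  The next cell after \<open>y\<close> is at distance 1, so an outgoing edge of larger weight has to be
  subdivided first.
\<close>

definition lookup_heap :: "'p \<Rightarrow> 'p \<Rightarrow> 'p heap \<Rightarrow> 'p heap \<Rightarrow> bool" where
  "lookup_heap x y H H' \<longleftrightarrow> (\<exists>S v. (S = H \<or> subdivides H S) \<and>
     (label S y, v) \<in> edges S \<and> weight S (label S y, v) = 1 \<and>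
     H' = S\<lparr>label := (label S)(x := v)\<rparr>)"

definition update_heap :: "'p \<Rightarrow> 'p \<Rightarrow> 'p heap \<Rightarrow> 'p heap \<Rightarrow> bool" where
  "update_heap x y H H' \<longleftrightarrow> (\<exists>v. (label H x, v) \<in> edges H \<and>
     H' = H\<lparr>edges := insert (label H x, label H y) (edges H - {(label H x, v)}),
            weight := (weight H)((label H x, label H y) := 1)\<rparr>)"

section \<open>Formulae\<close>

text \<open>
  Type variables: \<open>'h\<close> heap variables, \<open>'p\<close> pointer variables, \<open>'a\<close> variables of the background
  theory, \<open>'f\<close> and \<open>'r\<close> its function and relation symbols, \<open>'d\<close> its domain. The function
  \<open>of_length\<close> says how the background theory represents the lengths and \<open>\<infinity>\<close>.
\<close>

record ('f, 'r, 'd) background =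
  fun_of :: "'f \<Rightarrow> 'd list \<Rightarrow> 'd"
  rel_of :: "'r \<Rightarrow> 'd list \<Rightarrow> bool"
  of_length :: "enat \<Rightarrow> 'd"

datatype ('h, 'p, 'a, 'f) slh_term =
    Var 'a
  | App 'f "('h, 'p, 'a, 'f) slh_term list"
  | PathLength 'h 'p 'p

text \<open>In the last four atoms the first heap variable is \<open>h'\<close>, e.g. \<open>h' = new(h, x)\<close>.\<close>

datatype ('h, 'p, 'a, 'f, 'r) slh_form =
    Lit 'r "('h, 'p, 'a, 'f) slh_term list"
  | Alias 'h 'p 'p
  | IsPath 'h 'p 'p
  | IsNull 'h 'p
  | Circular 'h 'p
  | New 'h 'h 'p
  | Assign 'h 'h 'p 'p
  | Lookup 'h 'h 'p 'p
  | Update 'h 'h 'p 'p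
  | Neg "('h, 'p, 'a, 'f, 'r) slh_form"
  | Conj "('h, 'p, 'a, 'f, 'r) slh_form" "('h, 'p, 'a, 'f, 'r) slh_form"
  | Disj "('h, 'p, 'a, 'f, 'r) slh_form" "('h, 'p, 'a, 'f, 'r) slh_form"

record ('h, 'p, 'a, 'd) interp =
  heap_of :: "'h \<Rightarrow> 'p heap"
  val_of :: "'a \<Rightarrow> 'd"

definition interpretation_slh :: "('h, 'p::pointer, 'a, 'd) interp \<Rightarrow> bool" where
  "interpretation_slh \<Gamma> \<longleftrightarrow> (\<forall>h. singly_linked (heap_of \<Gamma> h))"

primrec term_val ::
  "('f, 'r, 'd) background \<Rightarrow> ('h, 'p, 'a, 'd) interp \<Rightarrow> ('h, 'p, 'a, 'f) slh_term \<Rightarrow> 'd"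
where
  "term_val T \<Gamma> (Var a) = val_of \<Gamma> a"
| "term_val T \<Gamma> (App f ts) = fun_of T f (map (term_val T \<Gamma>) ts)"
| "term_val T \<Gamma> (PathLength h x y) = of_length T (path_length (heap_of \<Gamma> h) x y)"

text \<open>
  The equality in \<open>h' = new(h, x)\<close> etc. is equality up to homeomorphism. It cannot be equality
  of graphs: for instance, \<open>assign\<close> may remove the last label of a vertex, after which no kernel
  is equal (or isomorphic) to the resulting heap.
\<close>

primrec sat ::
  "('f, 'r, 'd) background \<Rightarrow> ('h, 'p::pointer, 'a, 'd) interp \<Rightarrow>
   ('h, 'p, 'a, 'f, 'r) slh_form \<Rightarrow> bool"
where
  "sat T \<Gamma> (Lit r ts) \<longleftrightarrow> rel_of T r (map (term_val T \<Gamma>) ts)"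
| "sat T \<Gamma> (Alias h x y) \<longleftrightarrow> is_alias (heap_of \<Gamma> h) x y"
| "sat T \<Gamma> (IsPath h x y) \<longleftrightarrow> is_path (heap_of \<Gamma> h) x y"
| "sat T \<Gamma> (IsNull h x) \<longleftrightarrow> is_null (heap_of \<Gamma> h) x"
| "sat T \<Gamma> (Circular h x) \<longleftrightarrow> circular (heap_of \<Gamma> h) x"
| "sat T \<Gamma> (New h' h x) \<longleftrightarrow> (\<exists>H. new_heap x (heap_of \<Gamma> h) H \<and> heap_of \<Gamma> h' \<sim> H)"
| "sat T \<Gamma> (Assign h' h x y) \<longleftrightarrow> (\<exists>H. assign_heap x y (heap_of \<Gamma> h) H \<and> heap_of \<Gamma> h' \<sim> H)"
| "sat T \<Gamma> (Lookup h' h x y) \<longleftrightarrow> (\<exists>H. lookup_heap x y (heap_of \<Gamma> h) H \<and> heap_of \<Gamma> h' \<sim> H)"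
| "sat T \<Gamma> (Update h' h x y) \<longleftrightarrow> (\<exists>H. update_heap x y (heap_of \<Gamma> h) H \<and> heap_of \<Gamma> h' \<sim> H)"
| "sat T \<Gamma> (Neg \<phi>) \<longleftrightarrow> \<not> sat T \<Gamma> \<phi>"
| "sat T \<Gamma> (Conj \<phi> \<psi>) \<longleftrightarrow> sat T \<Gamma> \<phi> \<and> sat T \<Gamma> \<psi>"
| "sat T \<Gamma> (Disj \<phi> \<psi>) \<longleftrightarrow> sat T \<Gamma> \<phi> \<or> sat T \<Gamma> \<psi>"

end

theory Submission
  imports Defs
begin

text \<open>
  An edge of weight \<open>n\<close> stands for \<open>n\<close> consecutive list cells, and a pointer variable \<open>p\<close> together
  with a distance \<open>n\<close> is an address of the cell reached from \<open>p\<close> after \<open>n\<close> steps. For heaps of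
  outdegree at most 1, the relation "these two addresses name the same cell" is a complete
  invariant of homeomorphism: subdivisions and isomorphisms preserve it, and conversely it
  determines the reachable part of a subdivision into edges of weight 1. All observations can be
  read off this relation, and every transformer acts on it by an explicit translation of addresses.
  Hence replacing every heap by a homeomorphic one preserves the truth of every formula. A kernel
  is a heap with the fewest vertices among the singly linked heaps with the given relation.
\<close>

lemma single_valued_same_kernel_bij_betw:
  assumes single_valued_r: "single_valued r" and single_valued_s: "single_valued s" and same_kernel: "r O r\<inverse> = s O s\<inverse>"
  obtains g where "bij_betw g (Range r) (Range s)" "\<And>a c. (a, c) \<in> r \<Longrightarrow> (a, g c) \<in> s"
proof -
  have kernel: "(\<exists>c. (a, c) \<in> r \<and> (b, c) \<in> r) \<longleftrightarrow> (\<exists>c. (a, c) \<in> s \<and> (b, c) \<in> s)" for a b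
    using same_kernel by (auto simp: set_eq_iff relcomp_unfold)
  have "\<exists>c'. \<forall>a. (a, c) \<in> r \<longrightarrow> (a, c') \<in> s" for c
  proof (cases "c \<in> Range r")
    case True
    then obtain a c' where related: "(a, c) \<in> r" "(a, c') \<in> s" using kernel by blast
    have "(b, c') \<in> s" if "(b, c) \<in> r" for b
      using kernel[of a b] related that single_valuedD[OF single_valued_s] by blast
    then show ?thesis by blast
  qed blast
  then obtain g where g_related: "(a, g c) \<in> s" if "(a, c) \<in> r" for a c by metis
  have "inj_on g (Range r)"
  proof (rule inj_onI)
    fix c d assume "c \<in> Range r" "d \<in> Range r" "g c = g d"
    then obtain a b where "(a, c) \<in> r" "(b, d) \<in> r" by blast
    moreover from this have "\<exists>e. (a, e) \<in> r \<and> (b, e) \<in> r"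
      using kernel g_related \<open>g c = g d\<close> by metis
    ultimately show "c = d" using single_valuedD[OF single_valued_r] by metis
  qed
  moreover have "Range s \<subseteq> g ` Range r"
  proof
    fix d assume "d \<in> Range s"
    then obtain a where ad: "(a, d) \<in> s" by blast
    then obtain c where "(a, c) \<in> r" using kernel by blast
    then show "d \<in> g ` Range r" using ad g_related single_valuedD[OF single_valued_s] by blast
  qed
  ultimately have "bij_betw g (Range r) (Range s)"
    unfolding bij_betw_def using g_related by blast
  then show ?thesis using that g_related by blast
qed

section \<open>Heaps of outdegree at most 1\<close>

lemma heap_finite_verts: "heap H \<Longrightarrow> finite (verts H)"
  by (simp add: heap_def)

lemma heap_finite_edges: "heap H \<Longrightarrow> finite (edges H)"
  unfolding heap_def by (meson finite_SigmaI finite_subset)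

lemma heap_edge_source: "heap H \<Longrightarrow> (u, v) \<in> edges H \<Longrightarrow> u \<in> verts H"
  and heap_edge_target: "heap H \<Longrightarrow> (u, v) \<in> edges H \<Longrightarrow> v \<in> verts H"
  by (auto simp: heap_def)

lemma heap_finite_successors: "heap H \<Longrightarrow> finite {t. (u, t) \<in> edges H}"
  by (rule finite_subset[OF _ heap_finite_verts]) (auto intro: heap_edge_target)

lemma heap_weight_pos: "heap H \<Longrightarrow> e \<in> edges H \<Longrightarrow> 0 < weight H e"
  by (simp add: heap_def)

lemma heap_label_in_verts: "heap H \<Longrightarrow> label H p \<in> verts H"
  by (auto simp: heap_def)

lemma reachable_label: "label H p \<in> reachable H"
  by (auto simp: reachable_def)

lemma reachable_edge: "u \<in> reachable H \<Longrightarrow> (u, v) \<in> edges H \<Longrightarrow> v \<in> reachable H"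
  unfolding reachable_def by (blast intro: rtrancl_into_rtrancl)

lemma reachable_subset_verts:
  assumes "heap H"
  shows "reachable H \<subseteq> verts H"
proof -
  have "v \<in> verts H" if "(label H p, v) \<in> (edges H)\<^sup>*" for p v
    using that
    by (cases rule: rtranclE)
      (auto intro: heap_label_in_verts[OF assms] heap_edge_target[OF assms])
  then show ?thesis by (auto simp: reachable_def)
qed

locale functional_heap =
  fixes H :: "'p heap"
  assumes heap: "heap H" and single_valued_edges: "single_valued (edges H)"

lemma singly_linked_imp_functional_heap:
  assumes "singly_linked H"
  shows "functional_heap H"
proof
  show heap: "heap H" using assms by (simp add: singly_linked_def)
  show "single_valued (edges H)"
  proof (rule single_valuedI)
    fix u v w assume uv: "(u, v) \<in> edges H" and uw: "(u, w) \<in> edges H"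
    have "card {t. (u, t) \<in> edges H} \<le> 1"
      using assms heap_edge_source[OF heap uv] by (auto simp: singly_linked_def)
    then show "v = w"
      using heap_finite_successors[OF heap] uv uw by (auto simp: card_le_Suc0_iff_eq)
  qed
qed

section \<open>Cells and their addresses\<close>

type_synonym cell = "nat \<times> nat"
type_synonym 'p address = "'p \<times> nat"

text \<open>
  The pair \<open>(u, k)\<close> is the list cell at distance \<open>k\<close> from the vertex \<open>u\<close> on the edge that
  leaves \<open>u\<close>.
\<close>

inductive next_cell :: "'p heap \<Rightarrow> cell \<Rightarrow> cell \<Rightarrow> bool" for H where
  inner: "(u, v) \<in> edges H \<Longrightarrow> Suc k < weight H (u, v) \<Longrightarrow> next_cell H (u, k) (u, Suc k)"
| last: "(u, v) \<in> edges H \<Longrightarrow> Suc k = weight H (u, v) \<Longrightarrow> next_cell H (u, k) (v, 0)"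

definition naming :: "'p heap \<Rightarrow> ('p address \<times> cell) set" where
  "naming H = {((p, n), c). (next_cell H ^^ n) (label H p, 0) c}"

definition same_cell :: "'p heap \<Rightarrow> ('p address \<times> 'p address) set" where
  "same_cell H = naming H O (naming H)\<inverse>"

lemma next_cell_cong:
  assumes "\<And>v. (fst c, v) \<in> edges G \<longleftrightarrow> (fst c, v) \<in> edges H"
    and "\<And>v. (fst c, v) \<in> edges H \<Longrightarrow> weight G (fst c, v) = weight H (fst c, v)"
  shows "next_cell G c d \<longleftrightarrow> next_cell H c d"
  using assms by (cases c) (auto simp: next_cell.simps)

lemma next_cell_in_verts: "heap H \<Longrightarrow> next_cell H c d \<Longrightarrow> fst d \<in> verts H"
  by (auto elim!: next_cell.cases intro: heap_edge_source heap_edge_target)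

lemma (in functional_heap) next_cell_on_edge:
  assumes "(u, v) \<in> edges H"
  shows "next_cell H (u, k) d \<longleftrightarrow> k < weight H (u, v) \<and>
    d = (if Suc k = weight H (u, v) then (v, 0) else (u, Suc k))"
proof -
  have "(u, w) \<in> edges H \<longleftrightarrow> w = v" for w
    using assms single_valued_edges by (auto dest: single_valuedD)
  then show ?thesis by (auto simp: next_cell.simps)
qed

lemma (in functional_heap) next_cell_unique:
  assumes "next_cell H c d" "next_cell H c d'"
  shows "d = d'"
proof -
  obtain v where "(fst c, v) \<in> edges H" using assms(1) by (auto elim: next_cell.cases)
  from next_cell_on_edge[OF this, of "snd c"] show ?thesis using assms by simp
qed

lemma naming_0 [simp]: "((p, 0), c) \<in> naming H \<longleftrightarrow> c = (label H p, 0)"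
  by (auto simp: naming_def)

lemma naming_add:
  "((p, m + n), d) \<in> naming H \<longleftrightarrow> (\<exists>c. ((p, m), c) \<in> naming H \<and> (next_cell H ^^ n) c d)"
  by (auto simp: naming_def relpowp_add)

lemma naming_Suc:
  "((p, Suc n), d) \<in> naming H \<longleftrightarrow> (\<exists>c. ((p, n), c) \<in> naming H \<and> next_cell H c d)"
  by (auto simp: naming_def)

lemma naming_apsnd_Suc:
  "(apsnd Suc a, d) \<in> naming H \<longleftrightarrow> (\<exists>c. (a, c) \<in> naming H \<and> next_cell H c d)"
  by (cases a) (simp add: naming_Suc)

lemma (in functional_heap) single_valued_naming: "single_valued (naming H)"
  unfolding naming_def using relpowp_right_unique[OF next_cell_unique]
  by (auto intro!: single_valuedI)

lemma naming_inner_cell: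
  assumes "(a, (u, k)) \<in> naming H" "0 < k"
  shows "\<exists>v. (u, v) \<in> edges H \<and> k < weight H (u, v)"
proof -
  obtain p n where "a = (p, n)" by fastforce
  with assms show ?thesis by (cases n) (auto simp: naming_Suc elim: next_cell.cases)
qed

lemma (in functional_heap) naming_on_edge:
  assumes "(a, (u, k)) \<in> naming H" "(u, v) \<in> edges H"
  shows "k < weight H (u, v)"
  using naming_inner_cell[OF assms(1)] heap_weight_pos[OF heap] assms(2)
    single_valuedD[OF single_valued_edges] by (metis gr0I)

lemma naming_in_reachable:
  assumes "(a, c) \<in> naming H"
  shows "fst c \<in> reachable H"
proof -
  have "fst c \<in> reachable H" if "((p, n), c) \<in> naming H" for p n
    using that
  proof (induction n arbitrary: c)
    case (Suc n)
    then obtain b where "next_cell H b c" "fst b \<in> reachable H" by (auto simp: naming_Suc)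
    then show ?case by (cases rule: next_cell.cases) (auto intro: reachable_edge)
  qed (simp add: reachable_label)
  then show ?thesis using assms by (cases a) auto
qed

lemma naming_in_verts: "heap H \<Longrightarrow> (a, c) \<in> naming H \<Longrightarrow> fst c \<in> verts H"
  using naming_in_reachable reachable_subset_verts by blast

lemma same_cell_iff: "(a, b) \<in> same_cell H \<longleftrightarrow> (\<exists>c. (a, c) \<in> naming H \<and> (b, c) \<in> naming H)"
  by (auto simp: same_cell_def)

lemma (in functional_heap) next_cell_iff_same_cell:
  assumes "(a, c) \<in> naming H" "(b, d) \<in> naming H"
  shows "next_cell H c d \<longleftrightarrow> (apsnd Suc a, b) \<in> same_cell H"
  unfolding same_cell_iff naming_apsnd_Suc
  using assms single_valuedD[OF single_valued_naming] by blast

lemma same_cell_inv_image: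
  assumes "\<And>a c. (a, c) \<in> naming G \<longleftrightarrow> (f a, c) \<in> naming H"
  shows "same_cell G = inv_image (same_cell H) f"
  using assms by (auto simp: same_cell_iff)

lemma same_cell_embedding:
  assumes label: "\<And>p. g (label H p, 0) = (label H' p, 0)"
    and next_cell: "\<And>c d'. c \<in> Range (naming H) \<Longrightarrow>
      next_cell H' (g c) d' \<longleftrightarrow> (\<exists>d. next_cell H c d \<and> d' = g d)"
    and inj: "inj_on g (Range (naming H))"
  shows "same_cell H = same_cell H'"
proof -
  have "((p, n), c') \<in> naming H' \<longleftrightarrow> (\<exists>c. ((p, n), c) \<in> naming H \<and> c' = g c)" for p n c'
  proof (induction n arbitrary: c')
    case 0
    then show ?case using label by simp
  next
    case (Suc n)
    have "((p, Suc n), c') \<in> naming H' \<longleftrightarrow>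
        (\<exists>c. ((p, n), c) \<in> naming H \<and> next_cell H' (g c) c')"
      unfolding naming_Suc Suc.IH by blast
    also have "\<dots> \<longleftrightarrow> (\<exists>c. ((p, n), c) \<in> naming H \<and> (\<exists>d. next_cell H c d \<and> c' = g d))"
      using next_cell by blast
    finally show ?case unfolding naming_Suc by blast
  qed
  then have naming: "(a, c') \<in> naming H' \<longleftrightarrow> (\<exists>c. (a, c) \<in> naming H \<and> c' = g c)" for a c'
    by (cases a) simp
  have "(a, b) \<in> same_cell H \<longleftrightarrow> (a, b) \<in> same_cell H'" for a b
    unfolding same_cell_iff naming using inj_onD[OF inj _ RangeI RangeI] by blast
  then show ?thesis by (auto simp: set_eq_iff)
qed

section \<open>Observations\<close>

lemma path_snoc:
  assumes "path H u n v" "(v, t) \<in> edges H" "t \<in> verts H"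
  shows "path H u (n + weight H (v, t)) t"
  using assms
proof (induction rule: path.induct)
  case (1 v)
  then show ?case using path.intros(2)[of v t H 0 t] path.intros(1)[of t H] by simp
next
  case (2 u v n t')
  then show ?case using path.intros(2)[of u v H] by (simp add: add.assoc)
qed

lemma next_cell_along_edge:
  assumes "heap H" "(u, v) \<in> edges H"
  shows "(next_cell H ^^ weight H (u, v)) (u, 0) (v, 0)"
proof -
  have along: "(next_cell H ^^ k) (u, 0) (u, k)" if "k < weight H (u, v)" for k
    using that
  proof (induction k)
    case (Suc k)
    then show ?case using next_cell.inner[OF assms(2)] by auto
  qed simp
  obtain k where "weight H (u, v) = Suc k"
    using heap_weight_pos[OF assms] gr0_conv_Suc by blast
  then show ?thesis using along[of k] next_cell.last[OF assms(2)] by auto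
qed

lemma next_cell_relpowp_imp_path:
  assumes "heap H" "u \<in> verts H" "(next_cell H ^^ n) (u, 0) c"
  shows "\<exists>m. path H u m (fst c) \<and> n = m + snd c"
  using assms(3)
proof (induction n arbitrary: c)
  case 0
  then show ?case using path.intros(1)[OF assms(2)] by auto
next
  case (Suc n)
  then obtain b m where step: "next_cell H b c" and path: "path H u m (fst b)" "n = m + snd b"
    by fastforce
  from step show ?case
  proof (cases rule: next_cell.cases)
    case (last w v k)
    then show ?thesis
      using path path_snoc[OF _ last(3) heap_edge_target[OF assms(1) last(3)]] by fastforce
  qed (use path in auto)
qed

lemma path_iff_next_cell_relpowp:
  assumes "heap H" "u \<in> verts H"
  shows "path H u n t \<longleftrightarrow> (next_cell H ^^ n) (u, 0) (t, 0)"
proof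
  assume "path H u n t"
  then show "(next_cell H ^^ n) (u, 0) (t, 0)"
  proof (induction rule: path.induct)
    case (2 u v n t)
    then show ?case using next_cell_along_edge[OF assms(1)] by (auto simp: relpowp_add)
  qed simp
qed (use next_cell_relpowp_imp_path[OF assms] in fastforce)

lemma path_imp_rtrancl: "path H u n t \<Longrightarrow> (u, t) \<in> (edges H)\<^sup>*"
  by (induction rule: path.induct) auto

lemma trancl_iff_path:
  assumes "heap H"
  shows "(u, t) \<in> (edges H)\<^sup>+ \<longleftrightarrow> (\<exists>n>0. path H u n t)"
proof
  assume "(u, t) \<in> (edges H)\<^sup>+"
  then show "\<exists>n>0. path H u n t"
  proof (induction rule: converse_trancl_induct)
    case (base u)
    then show ?case
      using path.intros(2)[OF base path.intros(1)] heap_weight_pos[OF assms]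
        heap_edge_target[OF assms] by force
  next
    case (step u v)
    then show ?case using path.intros(2)[OF step(1)] by (metis add_gr_0)
  qed
next
  assume "\<exists>n>0. path H u n t"
  then obtain n where "path H u n t" "0 < n" by blast
  then show "(u, t) \<in> (edges H)\<^sup>+"
    by (cases rule: path.cases) (auto dest: path_imp_rtrancl intro: rtrancl_into_trancl2)
qed

lemma rtrancl_iff_path:
  assumes "heap H" "u \<in> verts H"
  shows "(u, t) \<in> (edges H)\<^sup>* \<longleftrightarrow> (\<exists>n. path H u n t)"
  using path_imp_rtrancl trancl_iff_path[OF assms(1)] path.intros(1)[OF assms(2)]
  by (metis rtranclD)

lemma path_label_iff_naming:
  assumes "heap H"
  shows "path H (label H p) n t \<longleftrightarrow> ((p, n), (t, 0)) \<in> naming H"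
  using path_iff_next_cell_relpowp[OF assms heap_label_in_verts[OF assms]]
  by (simp add: naming_def)

lemma reachable_iff_naming:
  assumes "heap H"
  shows "v \<in> reachable H \<longleftrightarrow> (\<exists>a. (a, (v, 0)) \<in> naming H)"
  by (simp add: reachable_def rtrancl_iff_path[OF assms heap_label_in_verts[OF assms]]
      path_label_iff_naming[OF assms])

lemma path_labels_iff_same_cell:
  assumes "heap H"
  shows "path H (label H x) n (label H y) \<longleftrightarrow> ((x, n), (y, 0)) \<in> same_cell H"
  by (simp add: path_label_iff_naming[OF assms] same_cell_iff)

lemma path_length_conv_same_cell:
  assumes "heap H"
  shows "path_length H x y = Inf {enat n | n. ((x, n), (y, 0)) \<in> same_cell H}"
  by (simp add: path_length_def path_labels_iff_same_cell[OF assms])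

lemma is_path_iff_same_cell:
  assumes "heap H"
  shows "is_path H x y \<longleftrightarrow> (\<exists>n. ((x, n), (y, 0)) \<in> same_cell H)"
  by (simp add: is_path_def rtrancl_iff_path[OF assms heap_label_in_verts[OF assms]]
      path_labels_iff_same_cell[OF assms])

lemma circular_iff_same_cell:
  assumes "heap H"
  shows "circular H x \<longleftrightarrow> (\<exists>n>0. ((x, n), (x, 0)) \<in> same_cell H)"
  by (simp add: circular_def trancl_iff_path[OF assms] path_labels_iff_same_cell[OF assms])

lemma is_alias_iff_same_cell: "is_alias H x y \<longleftrightarrow> ((x, 0), (y, 0)) \<in> same_cell H"
  by (auto simp: is_alias_def same_cell_iff)

lemma is_null_iff_same_cell: "is_null H x \<longleftrightarrow> ((x, 0), (null_ptr, 0)) \<in> same_cell H"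
  by (auto simp: is_null_def same_cell_iff)

section \<open>Subdivisions\<close>

locale edge_subdivision =
  fixes H S :: "'p heap" and u v q :: nat
  assumes heap_H: "heap H"
    and edge: "(u, v) \<in> edges H"
    and fresh: "q \<notin> verts H"
    and verts_S: "verts S = insert q (verts H)"
    and edges_S: "edges S = (edges H - {(u, v)}) \<union> {(u, q), (q, v)}"
    and weight_S: "\<And>e. e \<in> edges H - {(u, v)} \<Longrightarrow> weight S e = weight H e"
    and weight_S_pos: "0 < weight S (u, q)" "0 < weight S (q, v)"
    and weight_S_sum: "weight S (u, q) + weight S (q, v) = weight H (u, v)"
    and label_S: "label S = label H"

lemma subdivides_iff_edge_subdivision:
  assumes "heap H"
  shows "subdivides H S \<longleftrightarrow> (\<exists>u v q. edge_subdivision H S u v q)"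
  using assms by (simp add: subdivides_def edge_subdivision_def Ball_def)

lemma ex_edge_subdivision_unit:
  assumes heap: "heap H" and edge: "(u, v) \<in> edges H" and weight_gt_1: "1 < weight H (u, v)"
  shows "\<exists>S q. edge_subdivision H S u v q \<and> weight S (u, q) = 1"
proof -
  obtain q where fresh: "q \<notin> verts H" using heap_finite_verts[OF heap] ex_new_if_finite by blast
  have no_edge: "(a, q) \<notin> edges H" "(q, a) \<notin> edges H" for a
    using fresh heap_edge_source[OF heap] heap_edge_target[OF heap] by blast+
  then have "u \<noteq> q" using edge by blast
  define S where "S = H\<lparr>verts := insert q (verts H),
    edges := (edges H - {(u, v)}) \<union> {(u, q), (q, v)},
    weight := (weight H)((u, q) := 1, (q, v) := weight H (u, v) - 1)\<rparr>"
  have "edge_subdivision H S u v q"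
    using heap edge weight_gt_1 fresh no_edge \<open>u \<noteq> q\<close> by unfold_locales (auto simp: S_def)
  moreover have "weight S (u, q) = 1" using \<open>u \<noteq> q\<close> by (simp add: S_def)
  ultimately show ?thesis by blast
qed

definition inner_cell_count :: "'p heap \<Rightarrow> nat" where
  "inner_cell_count H = (\<Sum>e\<in>edges H. weight H e - 1)"

context edge_subdivision
begin

lemma no_edge_fresh: "(a, q) \<notin> edges H" "(q, a) \<notin> edges H"
  using fresh heap_edge_source[OF heap_H] heap_edge_target[OF heap_H] by blast+

lemma endpoints_ne_fresh: "u \<noteq> q" "v \<noteq> q"
  using edge no_edge_fresh by blast+

lemma heap_S: "heap S"
  unfolding heap_def
proof (intro conjI ballI)
  show "finite (verts S)" using heap_finite_verts[OF heap_H] by (simp add: verts_S)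
  show "edges S \<subseteq> verts S \<times> verts S"
    using heap_edge_source[OF heap_H] heap_edge_target[OF heap_H] edge
    by (auto simp: edges_S verts_S)
  show "0 < weight S e" if "e \<in> edges S" for e
    using that weight_S[of e] weight_S_pos heap_weight_pos[OF heap_H, of e]
    by (cases "e \<in> edges H - {(u, v)}") (auto simp: edges_S)
  show "range (label S) \<subseteq> verts S"
    using heap_label_in_verts[OF heap_H] by (auto simp: label_S verts_S)
qed

lemma card_successors_S:
  assumes "w \<in> verts H"
  shows "card {t. (w, t) \<in> edges S} = card {t. (w, t) \<in> edges H}"
proof (cases "w = u")
  case True
  have "{t. (u, t) \<in> edges S} = insert q ({t. (u, t) \<in> edges H} - {v})"
    using edges_S endpoints_ne_fresh by auto
  then show ?thesis
    using True heap_finite_successors[OF heap_H] edge no_edge_fresh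
    by (simp add: card_Suc_Diff1 del: card_Diff_insert)
next
  case False
  then have "{t. (w, t) \<in> edges S} = {t. (w, t) \<in> edges H}" using edges_S assms fresh by auto
  then show ?thesis by simp
qed

lemma card_verts_S: "card (verts S) = Suc (card (verts H))"
  using heap_finite_verts[OF heap_H] fresh by (simp add: verts_S)

lemma inner_cell_count_S: "Suc (inner_cell_count S) = inner_cell_count H"
proof -
  let ?E = "edges H - {(u, v)}"
  have finite: "finite ?E" using heap_finite_edges[OF heap_H] by simp
  have "inner_cell_count S =
      (\<Sum>e\<in>?E. weight S e - 1) + (weight S (u, q) - 1) + (weight S (q, v) - 1)"
    using finite no_edge_fresh endpoints_ne_fresh
    by (simp add: inner_cell_count_def edges_S)
  also have "(\<Sum>e\<in>?E. weight S e - 1) = (\<Sum>e\<in>?E. weight H e - 1)"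
    using weight_S by (intro sum.cong) auto
  also have "Suc (\<dots> + (weight S (u, q) - 1) + (weight S (q, v) - 1)) =
      (\<Sum>e\<in>?E. weight H e - 1) + (weight H (u, v) - 1)"
    using weight_S_pos weight_S_sum by linarith
  also have "\<dots> = inner_cell_count H"
    using heap_finite_edges[OF heap_H] edge by (simp add: inner_cell_count_def sum.remove)
  finally show ?thesis .
qed

end

locale functional_edge_subdivision = edge_subdivision H S u v q + H: functional_heap H
  for H S :: "'p heap" and u v q :: nat
begin

lemma functional_heap_S: "functional_heap S"
proof
  show "single_valued (edges S)"
  proof (rule single_valuedI)
    fix a b c assume "(a, b) \<in> edges S" "(a, c) \<in> edges S"
    then show "b = c"
      using single_valuedD[OF H.single_valued_edges] edge no_edge_fresh endpoints_ne_fresh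
      unfolding edges_S by auto
  qed
qed (rule heap_S)

sublocale S: functional_heap S
  by (rule functional_heap_S)

definition merge_cell :: "cell \<Rightarrow> cell" where
  "merge_cell c = (if fst c = q then (u, weight S (u, q) + snd c) else c)"

lemma next_cell_on_halves:
  "next_cell S (u, k) d \<longleftrightarrow>
     k < weight S (u, q) \<and> d = (if Suc k = weight S (u, q) then (q, 0) else (u, Suc k))"
  "next_cell S (q, k) d \<longleftrightarrow>
     k < weight S (q, v) \<and> d = (if Suc k = weight S (q, v) then (v, 0) else (q, Suc k))"
  using S.next_cell_on_edge edges_S by simp_all

lemma naming_on_first_half: "(a, (u, k)) \<in> naming S \<Longrightarrow> k < weight S (u, q)"
  using S.naming_on_edge edges_S by simp

lemma inj_on_merge_cell: "inj_on merge_cell (Range (naming S))"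
proof (rule inj_onI)
  fix c d assume "c \<in> Range (naming S)" "d \<in> Range (naming S)" "merge_cell c = merge_cell d"
  then show "c = d"
    using endpoints_ne_fresh
    by (cases c; cases d) (auto simp: merge_cell_def dest: naming_on_first_half split: if_splits)
qed

lemma next_cell_merge_cell:
  assumes "c \<in> Range (naming S)"
  shows "next_cell H (merge_cell c) d' \<longleftrightarrow> (\<exists>d. next_cell S c d \<and> d' = merge_cell d)"
proof -
  obtain w k where c_def: "c = (w, k)" by fastforce
  note next_cell_on_edge = next_cell_on_halves H.next_cell_on_edge[OF edge]
  consider "w = u" | "w = q" | "w \<noteq> u" "w \<noteq> q" by blast
  then show ?thesis
  proof cases
    case 1
    then have "k < weight S (u, q)" using assms c_def naming_on_first_half by blast
    then show ?thesis
      using c_def 1 endpoints_ne_fresh weight_S_sum weight_S_pos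
      by (auto simp: next_cell_on_edge merge_cell_def)
  next
    case 2
    then show ?thesis
      using c_def endpoints_ne_fresh weight_S_sum weight_S_pos
      by (auto simp: next_cell_on_edge merge_cell_def)
  next
    case 3
    then have "merge_cell c = c" using c_def by (simp add: merge_cell_def)
    moreover have "next_cell S c d \<longleftrightarrow> next_cell H c d" for d
      using c_def 3 by (intro next_cell_cong) (auto simp: edges_S weight_S)
    moreover have "merge_cell d = d" if "next_cell H c d" for d
      using next_cell_in_verts[OF heap_H that] fresh by (auto simp: merge_cell_def)
    ultimately show ?thesis by metis
  qed
qed

lemma same_cell_S: "same_cell S = same_cell H"
proof (rule same_cell_embedding[where g = merge_cell])
  show "merge_cell (label S p, 0) = (label H p, 0)" for p
    using heap_label_in_verts[OF heap_H, of p] fresh by (auto simp: merge_cell_def label_S)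
qed (use next_cell_merge_cell inj_on_merge_cell in blast)+

end

lemma subdivides_functional_heap_same_cell:
  assumes "functional_heap H" "subdivides H S"
  shows "functional_heap S" "same_cell S = same_cell H"
proof -
  obtain u v q where "edge_subdivision H S u v q"
    using assms subdivides_iff_edge_subdivision functional_heap.heap by blast
  then interpret functional_edge_subdivision H S u v q
    using assms(1) by (rule functional_edge_subdivision.intro)
  show "functional_heap S" "same_cell S = same_cell H"
    by (rule functional_heap_S same_cell_S)+
qed

lemma subdivides_rtranclp_functional_heap_same_cell:
  assumes "subdivides\<^sup>*\<^sup>* H S" "functional_heap H"
  shows "functional_heap S \<and> same_cell S = same_cell H"
  using assms
  by (induction rule: rtranclp_induct)
    (auto dest: subdivides_functional_heap_same_cell)

definition unit_weights :: "'p heap \<Rightarrow> bool" where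
  "unit_weights H \<longleftrightarrow> (\<forall>e\<in>edges H. weight H e = 1)"

lemma ex_unit_weights_subdivision:
  assumes "heap H"
  shows "\<exists>S. subdivides\<^sup>*\<^sup>* H S \<and> unit_weights S"
  using assms
proof (induction "inner_cell_count H" arbitrary: H rule: less_induct)
  case less
  show ?case
  proof (cases "unit_weights H")
    case False
    then obtain u v where "(u, v) \<in> edges H" "weight H (u, v) \<noteq> 1"
      by (auto simp: unit_weights_def)
    moreover from this have "1 < weight H (u, v)" using heap_weight_pos[OF less.prems] by force
    ultimately obtain S q where "edge_subdivision H S u v q"
      using ex_edge_subdivision_unit[OF less.prems] by blast
    then interpret edge_subdivision H S u v q .
    have "inner_cell_count S < inner_cell_count H" using inner_cell_count_S by simp
    then obtain S' where "subdivides\<^sup>*\<^sup>* S S'" "unit_weights S'"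
      using less.hyps heap_S by blast
    moreover have "subdivides H S"
      using subdivides_iff_edge_subdivision[OF heap_H] edge_subdivision_axioms by blast
    ultimately show ?thesis by (meson converse_rtranclp_into_rtranclp)
  qed blast
qed

section \<open>Homeomorphism in terms of addresses\<close>

locale heap_isomorphism =
  fixes H H' :: "'p heap" and f :: "nat \<Rightarrow> nat"
  assumes bij: "bij_betw f (reachable H) (reachable H')"
    and edge_iff: "\<And>u v. u \<in> reachable H \<Longrightarrow> v \<in> reachable H \<Longrightarrow>
      (u, v) \<in> edges H \<longleftrightarrow> (f u, f v) \<in> edges H'"
    and weight: "\<And>u v. u \<in> reachable H \<Longrightarrow> v \<in> reachable H \<Longrightarrow> (u, v) \<in> edges H \<Longrightarrow>
      weight H' (f u, f v) = weight H (u, v)"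
    and label: "\<And>p. f (label H p) = label H' p"

lemma isomorphic_iff_heap_isomorphism: "isomorphic H H' \<longleftrightarrow> (\<exists>f. heap_isomorphism H H' f)"
  unfolding isomorphic_def heap_isomorphism_def by blast

context heap_isomorphism
begin

lemma successor_image:
  assumes reachable: "u \<in> reachable H"
  shows "(f u, v') \<in> edges H' \<longleftrightarrow> (\<exists>v. (u, v) \<in> edges H \<and> v' = f v)"
proof
  assume edge: "(f u, v') \<in> edges H'"
  have "v' \<in> reachable H'" using bij_betwE[OF bij] reachable edge reachable_edge by blast
  then obtain v where "v \<in> reachable H" "v' = f v" using bij by (auto simp: bij_betw_def)
  then show "\<exists>v. (u, v) \<in> edges H \<and> v' = f v" using edge_iff reachable edge by blast
qed (use edge_iff reachable reachable_edge in blast)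

lemma next_cell_image:
  assumes reachable: "u \<in> reachable H"
  shows "next_cell H' (f u, k) d' \<longleftrightarrow> (\<exists>d. next_cell H (u, k) d \<and> d' = map_prod f id d)"
proof -
  have "weight H' (f u, f v) = weight H (u, v)" if "(u, v) \<in> edges H" for v
    using weight reachable that reachable_edge by blast
  then show ?thesis
    unfolding next_cell.simps[of H] next_cell.simps[of H']
    by (auto simp: successor_image[OF reachable])
qed

lemma same_cell_eq: "same_cell H = same_cell H'"
proof (rule same_cell_embedding[where g = "map_prod f id"])
  have Range: "Range (naming H) \<subseteq> reachable H \<times> UNIV"
    using naming_in_reachable by fastforce
  show "inj_on (map_prod f id) (Range (naming H))"
    using map_prod_inj_on[OF bij_betw_imp_inj_on[OF bij] inj_on_id] Range
    by (rule inj_on_subset)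
  fix c d' assume "c \<in> Range (naming H)"
  then obtain u k where "c = (u, k)" "u \<in> reachable H" using Range by blast
  then show "next_cell H' (map_prod f id c) d' \<longleftrightarrow> (\<exists>d. next_cell H c d \<and> d' = map_prod f id d)"
    using next_cell_image by simp
qed (simp add: label)

end

lemma same_cell_imp_bij_betw:
  assumes "functional_heap H" "functional_heap H'" and same_cell: "same_cell H = same_cell H'"
  obtains g where "bij_betw g (Range (naming H)) (Range (naming H'))"
    "\<And>p. g (label H p, 0) = (label H' p, 0)"
    "\<And>c d. c \<in> Range (naming H) \<Longrightarrow> d \<in> Range (naming H) \<Longrightarrow>
      next_cell H c d \<longleftrightarrow> next_cell H' (g c) (g d)"
proof -
  interpret H: functional_heap H by fact
  interpret H': functional_heap H' by fact
  obtain g where bij: "bij_betw g (Range (naming H)) (Range (naming H'))"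
    and naming_g: "\<And>a c. (a, c) \<in> naming H \<Longrightarrow> (a, g c) \<in> naming H'"
    using single_valued_same_kernel_bij_betw[OF H.single_valued_naming H'.single_valued_naming
        same_cell[unfolded same_cell_def]] by blast
  have "next_cell H c d \<longleftrightarrow> next_cell H' (g c) (g d)"
    if named: "c \<in> Range (naming H)" "d \<in> Range (naming H)" for c d
  proof -
    obtain a b where addresses: "(a, c) \<in> naming H" "(b, d) \<in> naming H" using named by blast
    then show ?thesis
      using H.next_cell_iff_same_cell[OF addresses] H'.next_cell_iff_same_cell[OF addresses[THEN naming_g]]
        same_cell by simp
  qed
  moreover have "g (label H p, 0) = (label H' p, 0)" for p
    using naming_g[of "(p, 0)" "(label H p, 0)"] by simp
  ultimately show ?thesis using that bij by blast
qed

lemma unit_weights_next_cell: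
  assumes "unit_weights H"
  shows "next_cell H (u, 0) (v, 0) \<longleftrightarrow> (u, v) \<in> edges H"
  using assms by (auto simp: unit_weights_def next_cell.simps)

lemma unit_weights_Range_naming:
  assumes heap: "heap H" and unit: "unit_weights H"
  shows "Range (naming H) = reachable H \<times> {0}"
proof -
  have "k = 0" if "(a, (u, k)) \<in> naming H" for a u k
    using naming_inner_cell[OF that] unit by (fastforce simp: unit_weights_def)
  then show ?thesis
    using reachable_iff_naming[OF heap] naming_in_reachable by fastforce
qed

lemma unit_weights_isomorphic:
  assumes functional: "functional_heap H" "functional_heap H'"
    and unit: "unit_weights H" "unit_weights H'"
    and same_cell: "same_cell H = same_cell H'"
  shows "isomorphic H H'"
proof -
  note Range_naming = functional[THEN functional_heap.heap] unit unit_weights_Range_naming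
  obtain g where bij_g: "bij_betw g (reachable H \<times> {0}) (reachable H' \<times> {0})"
    and label_g: "\<And>p. g (label H p, 0) = (label H' p, 0)"
    and next_cell_g: "\<And>c d. c \<in> reachable H \<times> {0} \<Longrightarrow> d \<in> reachable H \<times> {0} \<Longrightarrow>
      next_cell H c d \<longleftrightarrow> next_cell H' (g c) (g d)"
    using same_cell_imp_bij_betw[OF functional same_cell] Range_naming by metis
  define f where "f v = fst (g (v, 0))" for v
  have g_vertex: "g (v, 0) = (f v, 0)" if "v \<in> reachable H" for v
    using bij_betwE[OF bij_g] that by (auto simp: f_def prod_eq_iff mem_Times_iff)
  have "bij_betw (\<lambda>v. (v, 0 :: nat)) A (A \<times> {0})" "bij_betw fst (A \<times> {0 :: nat}) A"
    for A :: "nat set"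
    by (auto simp: bij_betw_def inj_on_def image_iff)
  from bij_betw_trans[OF bij_betw_trans[OF this(1) bij_g] this(2)]
  have "bij_betw f (reachable H) (reachable H')" by (simp add: f_def[abs_def] comp_def)
  moreover have "(u, v) \<in> edges H \<longleftrightarrow> (f u, f v) \<in> edges H'"
    if "u \<in> reachable H" "v \<in> reachable H" for u v
    using next_cell_g[of "(u, 0)" "(v, 0)"] g_vertex that by (simp add: unit_weights_next_cell unit)
  moreover have "weight H' (f u, f v) = weight H (u, v)"
    if "(u, v) \<in> edges H" "(f u, f v) \<in> edges H'" for u v
    using unit that by (simp add: unit_weights_def)
  ultimately have "heap_isomorphism H H' f"
    using label_g by unfold_locales (simp_all add: f_def)
  then show ?thesis by (auto simp: isomorphic_iff_heap_isomorphism)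
qed

theorem homeomorphic_iff_same_cell:
  assumes functional_H: "functional_heap H" and functional_H': "functional_heap H'"
  shows "H \<sim> H' \<longleftrightarrow> same_cell H = same_cell H'"
proof
  assume "H \<sim> H'"
  then show "same_cell H = same_cell H'"
    unfolding homeomorphic_def
    using subdivides_rtranclp_functional_heap_same_cell[OF _ functional_H]
      subdivides_rtranclp_functional_heap_same_cell[OF _ functional_H']
      isomorphic_iff_heap_isomorphism heap_isomorphism.same_cell_eq by metis
next
  assume same_cell: "same_cell H = same_cell H'"
  obtain S where S: "subdivides\<^sup>*\<^sup>* H S" "unit_weights S"
    using ex_unit_weights_subdivision functional_heap.heap[OF functional_H] by blast
  obtain S' where S': "subdivides\<^sup>*\<^sup>* H' S'" "unit_weights S'"
    using ex_unit_weights_subdivision functional_heap.heap[OF functional_H'] by blast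
  have "isomorphic S S'"
    using subdivides_rtranclp_functional_heap_same_cell[OF S(1) functional_H]
      subdivides_rtranclp_functional_heap_same_cell[OF S'(1) functional_H'] S(2) S'(2) same_cell
    by (intro unit_weights_isomorphic) simp_all
  then show "H \<sim> H'" using S(1) S'(1) by (auto simp: homeomorphic_def)
qed

section \<open>Transformers\<close>

lemma ex_homeomorphic_iff:
  assumes "functional_heap A" and "\<And>G. R G \<Longrightarrow> functional_heap G \<and> same_cell G = E"
  shows "(\<exists>G. R G \<and> A \<sim> G) \<longleftrightarrow> (\<exists>G. R G) \<and> same_cell A = E"
  using assms homeomorphic_iff_same_cell by metis

lemma ex_edge_iff_same_cell:
  assumes "heap H"
  shows "(\<exists>v. (label H x, v) \<in> edges H) \<longleftrightarrow> ((x, 1), (x, 1)) \<in> same_cell H"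
proof
  assume "\<exists>v. (label H x, v) \<in> edges H"
  then obtain v where edge: "(label H x, v) \<in> edges H" by blast
  then have "\<exists>d. next_cell H (label H x, 0) d"
    using heap_weight_pos[OF assms edge] by (metis Suc_lessI next_cell.intros)
  then show "((x, 1), (x, 1)) \<in> same_cell H" by (auto simp: same_cell_iff naming_Suc)
qed (auto simp: same_cell_iff naming_Suc elim: next_cell.cases)

subsection \<open>Relabelling\<close>

lemma functional_heap_relabel:
  assumes "functional_heap H" "v \<in> verts H"
  shows "functional_heap (H\<lparr>label := (label H)(x := v)\<rparr>)"
  using assms by (auto simp: functional_heap_def heap_def)

lemma naming_relabel:
  assumes "functional_heap H" and named: "((r, k), (l p, 0)) \<in> naming H"
  shows "((p, n), c) \<in> naming (H\<lparr>label := l\<rparr>) \<longleftrightarrow> ((r, k + n), c) \<in> naming H"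
proof -
  interpret functional_heap H by fact
  have "next_cell (H\<lparr>label := l\<rparr>) = next_cell H"
    by (intro ext next_cell_cong) simp_all
  then have "((p, n), c) \<in> naming (H\<lparr>label := l\<rparr>) \<longleftrightarrow> (next_cell H ^^ n) (l p, 0) c"
    by (simp add: naming_def)
  also have "\<dots> \<longleftrightarrow> ((r, k + n), c) \<in> naming H"
    unfolding naming_add using named single_valuedD[OF single_valued_naming] by blast
  finally show ?thesis .
qed

lemma same_cell_relabel:
  assumes "functional_heap H" and "\<And>p. ((r p, k p), (l p, 0)) \<in> naming H"
  shows "same_cell (H\<lparr>label := l\<rparr>) = inv_image (same_cell H) (\<lambda>(p, n). (r p, k p + n))"
  using naming_relabel[OF assms] by (intro same_cell_inv_image) (auto split: prod.split)

definition assign_address :: "'p \<Rightarrow> 'p \<Rightarrow> 'p address \<Rightarrow> 'p address" where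
  "assign_address x y = (\<lambda>(p, n). (if p = x then y else p, n))"

definition lookup_address :: "'p \<Rightarrow> 'p \<Rightarrow> 'p address \<Rightarrow> 'p address" where
  "lookup_address x y = (\<lambda>(p, n). if p = x then (y, Suc n) else (p, n))"

lemma assign_heap_homeomorphic_iff:
  assumes functional_H: "functional_heap H" and functional_A: "functional_heap A"
  shows "(\<exists>G. assign_heap x y H G \<and> A \<sim> G) \<longleftrightarrow>
    same_cell A = inv_image (same_cell H) (assign_address x y)"
proof -
  let ?G = "H\<lparr>label := (label H)(x := label H y)\<rparr>"
  have "functional_heap ?G"
    by (intro functional_heap_relabel functional_H heap_label_in_verts functional_heap.heap)
  moreover have "same_cell ?G = inv_image (same_cell H) (assign_address x y)"
    using same_cell_relabel[OF functional_H, of "\<lambda>p. if p = x then y else p" "\<lambda>_. 0"]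
    by (simp add: assign_address_def)
  ultimately show ?thesis
    using ex_homeomorphic_iff[OF functional_A, of "assign_heap x y H"] by (simp add: assign_heap_def)
qed

lemma lookup_heap_functional_same_cell:
  assumes functional_H: "functional_heap H" and "lookup_heap x y H G"
  shows "functional_heap G \<and> same_cell G = inv_image (same_cell H) (lookup_address x y)"
proof -
  obtain S v where subdivision: "S = H \<or> subdivides H S" and unit_edge: "(label S y, v) \<in> edges S"
      "weight S (label S y, v) = 1" and G_def: "G = S\<lparr>label := (label S)(x := v)\<rparr>"
    using assms(2) by (auto simp: lookup_heap_def)
  have functional_S: "functional_heap S" and same_cell_S: "same_cell S = same_cell H"
    using subdivision functional_H subdivides_functional_heap_same_cell by blast+
  have "((y, 1), (v, 0)) \<in> naming S"
    using unit_edge(2) next_cell.last[OF unit_edge(1), of 0] by (simp add: naming_Suc)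
  then have "same_cell G = inv_image (same_cell S)
      (\<lambda>(p, n). (if p = x then y else p, (if p = x then 1 else 0) + n))"
    unfolding G_def by (intro same_cell_relabel functional_S) simp
  also have "\<dots> = inv_image (same_cell H) (lookup_address x y)"
    unfolding same_cell_S lookup_address_def
    by (intro arg_cong[of _ _ "inv_image (same_cell H)"]) auto
  finally show ?thesis
    unfolding G_def using functional_heap_relabel[OF functional_S]
      heap_edge_target[OF functional_heap.heap[OF functional_S] unit_edge(1)] by blast
qed

lemma ex_lookup_heap_iff:
  assumes functional_H: "functional_heap H"
  shows "(\<exists>G. lookup_heap x y H G) \<longleftrightarrow> ((y, 1), (y, 1)) \<in> same_cell H"
proof
  interpret functional_heap H by fact
  assume "((y, 1), (y, 1)) \<in> same_cell H"
  then obtain v where edge: "(label H y, v) \<in> edges H" using ex_edge_iff_same_cell[OF heap] by blast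
  have "\<exists>S w. (S = H \<or> subdivides H S) \<and> (label S y, w) \<in> edges S \<and> weight S (label S y, w) = 1"
  proof (cases "weight H (label H y, v) = 1")
    case False
    then have "1 < weight H (label H y, v)" using heap_weight_pos[OF heap edge] by linarith
    then obtain S q where subdivision: "edge_subdivision H S (label H y) v q" "weight S (label H y, q) = 1"
      using ex_edge_subdivision_unit[OF heap edge] by blast
    then interpret edge_subdivision H S "label H y" v q by simp
    have "subdivides H S" using subdivision(1) subdivides_iff_edge_subdivision[OF heap] by blast
    moreover have "(label S y, q) \<in> edges S" "weight S (label S y, q) = 1"
      using subdivision(2) by (simp_all add: edges_S label_S)
    ultimately show ?thesis by blast
  qed (use edge in blast)
  then show "\<exists>G. lookup_heap x y H G" unfolding lookup_heap_def by blast
next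
  assume "\<exists>G. lookup_heap x y H G"
  then obtain S v where subdivision: "S = H \<or> subdivides H S" and edge: "(label S y, v) \<in> edges S"
    by (auto simp: lookup_heap_def)
  have "functional_heap S" "same_cell S = same_cell H"
    using subdivision functional_H subdivides_functional_heap_same_cell by blast+
  then show "((y, 1), (y, 1)) \<in> same_cell H"
    using edge ex_edge_iff_same_cell functional_heap.heap by metis
qed

lemma lookup_heap_homeomorphic_iff:
  assumes functional_H: "functional_heap H" and functional_A: "functional_heap A"
  shows "(\<exists>G. lookup_heap x y H G \<and> A \<sim> G) \<longleftrightarrow> ((y, 1), (y, 1)) \<in> same_cell H \<and>
    same_cell A = inv_image (same_cell H) (lookup_address x y)"
  using ex_homeomorphic_iff[OF functional_A lookup_heap_functional_same_cell[OF functional_H]] ex_lookup_heap_iff[OF functional_H]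
  by simp

subsection \<open>Adding a cell\<close>

text \<open>The value at \<open>(x, 0)\<close>, the address of the added cell, is meaningless.\<close>

definition new_address :: "'p::pointer \<Rightarrow> 'p address \<Rightarrow> 'p address" where
  "new_address x = (\<lambda>(p, n). if p = x then (null_ptr, n - 1) else (p, n))"

definition new_same_cell ::
  "'p::pointer \<Rightarrow> ('p address \<times> 'p address) set \<Rightarrow> ('p address \<times> 'p address) set" where
  "new_same_cell x E =
     insert ((x, 0), (x, 0)) (Restr (inv_image E (new_address x)) (- {(x, 0)}))"

locale cell_extension = functional_heap H for H G :: "'p::pointer heap" and q :: nat and x :: 'p +
  assumes fresh: "q \<notin> verts H"
    and G_def: "G = H\<lparr>verts := insert q (verts H),
            edges := insert (q, label H null_ptr) (edges H),
            weight := (weight H)((q, label H null_ptr) := 1),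
            label := (label H)(x := q)\<rparr>"
begin

lemma no_edge_fresh: "(q, v) \<notin> edges H"
  using fresh heap_edge_source[OF heap] by blast

lemma functional_heap_G: "functional_heap G"
proof
  show "heap G" using heap heap_label_in_verts[OF heap] by (auto simp: heap_def G_def)
  show "single_valued (edges G)"
    using single_valued_edges no_edge_fresh by (auto simp: G_def single_valued_def)
qed

lemma naming_G:
  "(a, c) \<in> naming G \<longleftrightarrow> (if a = (x, 0) then c = (q, 0) else (new_address x a, c) \<in> naming H)"
proof -
  interpret G: functional_heap G by (rule functional_heap_G)
  have next_cell_q: "next_cell G (q, 0) d \<longleftrightarrow> d = (label H null_ptr, 0)" for d
    using G.next_cell_on_edge[of q "label H null_ptr"] by (simp add: G_def)
  have next_cell: "next_cell G c d \<longleftrightarrow> next_cell H c d" if "(b, c) \<in> naming H" for b c d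
    using naming_in_verts[OF heap that] fresh by (intro next_cell_cong) (auto simp: G_def)
  have "((p, n), c) \<in> naming G \<longleftrightarrow>
      (if (p, n) = (x, 0) then c = (q, 0) else (new_address x (p, n), c) \<in> naming H)" for p n
  proof (induction n arbitrary: c)
    case 0
    then show ?case by (simp add: new_address_def G_def)
  next
    case (Suc n)
    show ?case
    proof (cases "(p, n) = (x, 0)")
      case True
      then show ?thesis using Suc next_cell_q by (simp add: naming_Suc new_address_def)
    next
      case False
      then have "new_address x (p, Suc n) = apsnd Suc (new_address x (p, n))"
        by (auto simp: new_address_def)
      moreover have "((p, n), c) \<in> naming G \<longleftrightarrow> (new_address x (p, n), c) \<in> naming H" for c
        unfolding Suc.IH using False by (rule if_not_P)
      ultimately show ?thesis
        using next_cell by (simp add: naming_Suc naming_apsnd_Suc cong: conj_cong)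
    qed
  qed
  then show ?thesis by (cases a) blast
qed

lemma same_cell_G: "same_cell G = new_same_cell x (same_cell H)"
proof -
  have "(a, (q, 0)) \<notin> naming H" for a using naming_in_verts[OF heap] fresh by fastforce
  then have "(a, b) \<in> same_cell G \<longleftrightarrow> (a, b) \<in> new_same_cell x (same_cell H)" for a b
    by (cases "a = (x, 0)"; cases "b = (x, 0)")
      (simp_all add: same_cell_iff new_same_cell_def naming_G)
  then show ?thesis by (simp add: set_eq_iff)
qed

end

lemma new_heap_homeomorphic_iff:
  assumes functional_H: "functional_heap H" and functional_A: "functional_heap A"
  shows "(\<exists>G. new_heap x H G \<and> A \<sim> G) \<longleftrightarrow> same_cell A = new_same_cell x (same_cell H)"
proof -
  have new_heap: "new_heap x H G \<longleftrightarrow> (\<exists>q. cell_extension H G q x)" for G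
    using functional_H by (simp add: new_heap_def cell_extension_def cell_extension_axioms_def)
  have "\<exists>q. q \<notin> verts H"
    using heap_finite_verts[OF functional_heap.heap[OF functional_H]] ex_new_if_finite by blast
  then have "\<exists>G. new_heap x H G" by (simp add: new_heap_def)
  moreover have "functional_heap G \<and> same_cell G = new_same_cell x (same_cell H)"
    if "new_heap x H G" for G
    using that unfolding new_heap
    by (auto dest: cell_extension.functional_heap_G cell_extension.same_cell_G)
  ultimately show ?thesis using ex_homeomorphic_iff[OF functional_A] by simp
qed

subsection \<open>Redirecting an edge\<close>

text \<open>Whenever a walk arrives at the cell of \<open>x\<close>, its next cell is that of \<open>y\<close>.\<close>

primrec redirect_address ::
  "('p address \<times> 'p address) set \<Rightarrow> 'p \<Rightarrow> 'p \<Rightarrow> 'p \<Rightarrow> nat \<Rightarrow> 'p address" where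
  "redirect_address E x y p 0 = (p, 0)"
| "redirect_address E x y p (Suc n) =
     (let a = redirect_address E x y p n in if (a, (x, 0)) \<in> E then (y, 0) else apsnd Suc a)"

definition update_same_cell ::
  "'p \<Rightarrow> 'p \<Rightarrow> ('p address \<times> 'p address) set \<Rightarrow> ('p address \<times> 'p address) set" where
  "update_same_cell x y E = inv_image E (\<lambda>(p, n). redirect_address E x y p n)"

locale edge_redirection = functional_heap H for H G :: "'p heap" and v :: nat and x y :: 'p +
  assumes edge: "(label H x, v) \<in> edges H"
    and G_def: "G = H\<lparr>edges := insert (label H x, label H y) (edges H - {(label H x, v)}),
            weight := (weight H)((label H x, label H y) := 1)\<rparr>"
begin

lemma functional_heap_G: "functional_heap G"
proof
  show "heap G" using heap heap_label_in_verts[OF heap] by (auto simp: heap_def G_def)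
  show "single_valued (edges G)"
    using single_valued_edges edge by (auto simp: G_def single_valued_def)
qed

lemma naming_G:
  "((p, n), c) \<in> naming G \<longleftrightarrow> (redirect_address (same_cell H) x y p n, c) \<in> naming H"
proof (induction n arbitrary: c)
  case 0
  then show ?case by (simp add: G_def)
next
  case (Suc n)
  interpret G: functional_heap G by (rule functional_heap_G)
  have edge_G: "(label H x, label H y) \<in> edges G" "weight G (label H x, label H y) = 1"
    by (simp_all add: G_def)
  let ?a = "redirect_address (same_cell H) x y p n"
  show ?case
  proof (cases "(?a, (x, 0)) \<in> same_cell H")
    case True
    then have "(?a, c) \<in> naming H \<longleftrightarrow> c = (label H x, 0)" for c
      using single_valuedD[OF single_valued_naming] unfolding same_cell_iff naming_0 by blast
    then show ?thesis
      using True Suc G.next_cell_on_edge[OF edge_G(1)] edge_G(2) by (simp add: naming_Suc)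
  next
    case False
    have "next_cell G c d \<longleftrightarrow> next_cell H c d" if named: "(?a, c) \<in> naming H" for c d
    proof -
      have "c \<noteq> (label H x, 0)" using named False by (auto simp: same_cell_iff)
      \<comment> \<open>The new edge has weight 1, so no walk in \<open>G\<close> meets a cell inside it.\<close>
      moreover have "snd c = 0" if "fst c = label H x"
        using G.naming_on_edge[of "(p, n)" "label H x" "snd c"] edge_G Suc named that
        by (metis less_one prod.collapse)
      ultimately have "fst c \<noteq> label H x" by (metis prod.collapse)
      then show ?thesis by (intro next_cell_cong) (auto simp: G_def)
    qed
    then show ?thesis using False Suc by (simp add: naming_Suc naming_apsnd_Suc cong: conj_cong)
  qed
qed

lemma same_cell_G: "same_cell G = update_same_cell x y (same_cell H)"
  unfolding update_same_cell_def by (rule same_cell_inv_image) (auto simp: naming_G)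

end

lemma update_heap_homeomorphic_iff:
  assumes functional_H: "functional_heap H" and functional_A: "functional_heap A"
  shows "(\<exists>G. update_heap x y H G \<and> A \<sim> G) \<longleftrightarrow>
    ((x, 1), (x, 1)) \<in> same_cell H \<and> same_cell A = update_same_cell x y (same_cell H)"
proof -
  have update_heap: "update_heap x y H G \<longleftrightarrow> (\<exists>v. edge_redirection H G v x y)" for G
    using functional_H by (simp add: update_heap_def edge_redirection_def edge_redirection_axioms_def)
  have "(\<exists>G. update_heap x y H G) \<longleftrightarrow> ((x, 1), (x, 1)) \<in> same_cell H"
    unfolding ex_edge_iff_same_cell[OF functional_heap.heap[OF functional_H], symmetric]
    by (auto simp: update_heap_def)
  moreover have "functional_heap G \<and> same_cell G = update_same_cell x y (same_cell H)"
    if "update_heap x y H G" for G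
    using that unfolding update_heap
    by (auto dest: edge_redirection.functional_heap_G edge_redirection.same_cell_G)
  ultimately show ?thesis using ex_homeomorphic_iff[OF functional_A] by simp
qed

section \<open>Soundness of homeomorphism\<close>

lemma term_val_homeomorphic:
  assumes "\<And>h. functional_heap (heap_of \<Gamma> h)" "\<And>h. functional_heap (heap_of \<Gamma>' h)"
    and "\<And>h. heap_of \<Gamma> h \<sim> heap_of \<Gamma>' h" and "val_of \<Gamma> = val_of \<Gamma>'"
  shows "term_val T \<Gamma> t = term_val T \<Gamma>' t"
proof (induction t)
  case (PathLength h x y)
  have "same_cell (heap_of \<Gamma> h) = same_cell (heap_of \<Gamma>' h)"
    using assms homeomorphic_iff_same_cell by blast
  then show ?case
    using assms(1,2) by (simp add: path_length_conv_same_cell functional_heap.heap)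
qed (use assms in \<open>auto cong: map_cong\<close>)

theorem sat_homeomorphic:
  fixes \<Gamma> \<Gamma>' :: "('h, 'p::pointer, 'a, 'd) interp"
  assumes functional: "\<And>h. functional_heap (heap_of \<Gamma> h)" "\<And>h. functional_heap (heap_of \<Gamma>' h)"
    and homeomorphic: "\<And>h. heap_of \<Gamma> h \<sim> heap_of \<Gamma>' h" and "val_of \<Gamma> = val_of \<Gamma>'"
  shows "sat T \<Gamma> \<phi> \<longleftrightarrow> sat T \<Gamma>' \<phi>"
proof -
  have "same_cell (heap_of \<Gamma> h) = same_cell (heap_of \<Gamma>' h)" for h
    using homeomorphic functional homeomorphic_iff_same_cell by blast
  moreover have "term_val T \<Gamma> = term_val T \<Gamma>'"
    using term_val_homeomorphic[OF assms] by blast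
  ultimately show ?thesis
    by (induction \<phi>)
      (simp_all add: functional functional[THEN functional_heap.heap]
        is_alias_iff_same_cell is_path_iff_same_cell is_null_iff_same_cell circular_iff_same_cell
        new_heap_homeomorphic_iff assign_heap_homeomorphic_iff
        lookup_heap_homeomorphic_iff update_heap_homeomorphic_iff)
qed

section \<open>Existence of kernels\<close>

definition reachable_part :: "'p heap \<Rightarrow> 'p heap" where
  "reachable_part H = H\<lparr>verts := reachable H, edges := edges H \<inter> reachable H \<times> UNIV\<rparr>"

lemma same_cell_reachable_part: "same_cell (reachable_part H) = same_cell H"
proof -
  have "same_cell H = same_cell (reachable_part H)"
  proof (rule same_cell_embedding[where g = id])
    fix c d assume "c \<in> Range (naming H)"
    then have "fst c \<in> reachable H" using naming_in_reachable by blast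
    then have "next_cell (reachable_part H) c d \<longleftrightarrow> next_cell H c d"
      by (intro next_cell_cong) (auto simp: reachable_part_def)
    then show "next_cell (reachable_part H) (id c) d \<longleftrightarrow> (\<exists>d'. next_cell H c d' \<and> d = id d')"
      unfolding id_apply by blast
  qed (simp_all add: reachable_part_def)
  then show ?thesis ..
qed

lemma singly_linked_reachable_part:
  assumes "singly_linked H"
  shows "singly_linked (reachable_part H)"
proof -
  have heap: "heap H" using assms by (simp add: singly_linked_def)
  have "heap (reachable_part H)"
    using heap reachable_subset_verts[OF heap] reachable_label reachable_edge
    by (auto simp: heap_def reachable_part_def intro: finite_subset)
  moreover have "{t. (v, t) \<in> edges (reachable_part H)} = {t. (v, t) \<in> edges H}"
    if "v \<in> reachable H" for v using that by (auto simp: reachable_part_def)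
  ultimately show ?thesis
    using assms reachable_subset_verts[OF heap] by (auto simp: singly_linked_def reachable_part_def)
qed

lemma
  assumes "singly_linked K" "smooths K K'"
  shows smooths_singly_linked: "singly_linked K'"
    and smooths_same_cell: "same_cell K' = same_cell K"
    and smooths_card_verts: "card (verts K') < card (verts K)"
proof -
  obtain u v q where "edge_subdivision K' K u v q"
    using assms(2) subdivides_iff_edge_subdivision unfolding smooths_def by blast
  then interpret edge_subdivision K' K u v q .
  show "singly_linked K'"
    using assms(1) heap_H card_successors_S by (simp add: singly_linked_def verts_S label_S)
  then show "same_cell K' = same_cell K"
    using subdivides_functional_heap_same_cell(2) singly_linked_imp_functional_heap assms(2)
    unfolding smooths_def by metis
  show "card (verts K') < card (verts K)" using card_verts_S by simp
qed

lemma ex_kernel: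
  assumes "singly_linked H"
  shows "\<exists>K. is_kernel_of K H"
proof -
  obtain K where K: "singly_linked K" "same_cell K = same_cell H"
    and least: "\<And>K'. singly_linked K' \<Longrightarrow> same_cell K' = same_cell H \<Longrightarrow>
      card (verts K) \<le> card (verts K')"
    using ex_has_least_nat[of "\<lambda>K. singly_linked K \<and> same_cell K = same_cell H" H
        "\<lambda>K. card (verts K)"] assms by blast
  have heap: "heap K" using K(1) by (simp add: singly_linked_def)
  have "card (verts K) \<le> card (verts (reachable_part K))"
    by (intro least) (simp_all add: K singly_linked_reachable_part same_cell_reachable_part)
  then have "reachable K = verts K"
    by (intro card_seteq heap_finite_verts heap reachable_subset_verts)
      (simp add: reachable_part_def)
  moreover have "\<nexists>K'. smooths K K'"
    using least K smooths_singly_linked smooths_same_cell smooths_card_verts by (metis leD)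
  moreover have "K \<sim> H"
    using homeomorphic_iff_same_cell singly_linked_imp_functional_heap K assms by blast
  ultimately show ?thesis using K(1) by (auto simp: is_kernel_of_def)
qed

theorem theorem3:
  fixes T :: "('f, 'r, 'd) background"
    and \<Gamma> :: "('h, 'p::pointer, 'a, 'd) interp"
    and \<phi> :: "('h, 'p, 'a, 'f, 'r) slh_form"
  assumes "interpretation_slh \<Gamma>"
    and "sat T \<Gamma> (Neg \<phi>)"
  shows "\<exists>\<Gamma>' :: ('h, 'p, 'a, 'd) interp.
           interpretation_slh \<Gamma>' \<and> sat T \<Gamma>' (Neg \<phi>) \<and>
           (\<forall>h. homeomorphism_kernel (heap_of \<Gamma>' h))"
proof -
  have singly_linked: "singly_linked (heap_of \<Gamma> h)" for h
    using assms(1) by (simp add: interpretation_slh_def)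
  then have "\<forall>h. \<exists>K. is_kernel_of K (heap_of \<Gamma> h)" using ex_kernel by blast
  then obtain K where is_kernel: "\<And>h. is_kernel_of (K h) (heap_of \<Gamma> h)" by metis
  then have kernel: "singly_linked (K h)" "K h \<sim> heap_of \<Gamma> h" for h
    by (simp_all add: is_kernel_of_def)
  let ?\<Gamma>' = "\<Gamma>\<lparr>heap_of := K\<rparr>"
  have "sat T ?\<Gamma>' (Neg \<phi>) \<longleftrightarrow> sat T \<Gamma> (Neg \<phi>)"
    using singly_linked kernel
    by (intro sat_homeomorphic singly_linked_imp_functional_heap) simp_all
  moreover have "interpretation_slh ?\<Gamma>'"
    using kernel(1) by (simp add: interpretation_slh_def)
  moreover have "homeomorphism_kernel (heap_of ?\<Gamma>' h)" for h
    using is_kernel singly_linked by (auto simp: homeomorphism_kernel_def)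
  ultimately show ?thesis using assms(2) by blast
qed

end
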